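(* Let $c>1$, let $\omega\in\mathbb{R}$ with $\omega>\frac{c^2}{4}$, and set $\sigma:=\omega-\frac{c^2}{4}>0$. If $0<\alpha<\frac{c-1}{4\sigma}$ and $\beta=3\alpha$, then the system $$iu_t+u_{xx}+uv=0,\qquad v_t+v_x+\beta(v^2)_x+\alpha v_{xxx}=-\tfrac12(|u|^2)_x$$ has a one-parameter family (with parameter $\kappa\in(0,1)$) of solutions of the form $$(u,v)=\left(e^{i\omega t}e^{i\frac{c}{2}(x-ct)}\varphi(x-ct),\ \psi(x-ct)\right),$$ where $$\varphi(x)=\varphi_0\,\mathrm{dn}(\gamma x,\kappa),\qquad \psi(x)=A\varphi^2(x),\qquad \kappa\in(0,1),$$ $$A=\frac{1}{2(c-1-4\alpha\sigma)}>0,\qquad \gamma^2=\frac{\sigma}{2-\kappa^2},\qquad \varphi_0^2=\frac{2\gamma^2}{A},$$ with $\gamma,\varphi_0>0$; equivalently, $(\varphi,\psi)$ solves $$\varphi''-\sigma\varphi+\varphi\psi=0,\qquad -c\psi'+\psi'+2\beta\psi\psi'+\alpha\psi'''=-\tfrac12(\varphi^2)'.$$ Moreover, $(\varphi,\psi)$ also satisfies $$\varphi''-\sigma\varphi+\varphi\psi=0,\qquad -c\psi+\psi+\beta\psi^2+\alpha\psi''+\tfrac12\varphi^2=b,\qquad\text{with } b=-4\alpha(1-\kappa^2)\gamma^4<0,$$ and $(\varphi,\psi)$ is periodic with period $\frac{2K(\kappa)}{\gamma}$.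
   Context: Here $u$ is complex-valued and $v$ is real-valued. $\mathrm{dn}(\cdot,\kappa)$ is the Jacobi elliptic function of modulus $\kappa$ and $K(\kappa)$ is the complete elliptic integral of the first kind of modulus $\kappa$. *)

theory Defs
  imports "HOL-Analysis.Analysis" "HOL-Library.Periodic_Fun"
begin

text \<open>
  Elliptic integrals and the Jacobi elliptic functions, for real arguments and modulus
  \<open>\<kappa>\<close> (not parameter \<open>m = \<kappa>\<^sup>2\<close>). The interval integral is oriented, so
  \<open>ellip_F\<close> is odd in its first argument.
\<close>

definition ellip_F :: "real \<Rightarrow> real \<Rightarrow> real" where
  "ellip_F \<theta> \<kappa> = (LBINT s=ereal 0..ereal \<theta>. 1 / sqrt (1 - \<kappa>\<^sup>2 * (sin s)\<^sup>2))"

definition ellip_K :: "real \<Rightarrow> real" where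
  "ellip_K \<kappa> = ellip_F (pi / 2) \<kappa>"

text \<open>
  For \<open>0 \<le> \<kappa> < 1\<close> the map \<open>\<theta> \<mapsto> ellip_F \<theta> \<kappa>\<close> is a bijection of the real line, so the
  description below denotes its inverse.
\<close>

definition jacobi_am :: "real \<Rightarrow> real \<Rightarrow> real" where
  "jacobi_am x \<kappa> = (THE \<theta>. ellip_F \<theta> \<kappa> = x)"

definition jacobi_sn :: "real \<Rightarrow> real \<Rightarrow> real" where
  "jacobi_sn x \<kappa> = sin (jacobi_am x \<kappa>)"

definition jacobi_dn :: "real \<Rightarrow> real \<Rightarrow> real" where
  "jacobi_dn x \<kappa> = sqrt (1 - \<kappa>\<^sup>2 * (jacobi_sn x \<kappa>)\<^sup>2)"

text \<open>
  Solutions are classical: every derivative occurring in an equation is required to exist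
  at every point. Fields are written as functions of \<open>x\<close> first and \<open>t\<close> second.
  The witnesses \<open>v2_x\<close> and \<open>m_x\<close> are the \<open>x\<close>-derivatives of \<open>v\<^sup>2\<close> and of \<open>|u|\<^sup>2\<close>.
\<close>

definition solves_system ::
    "real \<Rightarrow> real \<Rightarrow> (real \<Rightarrow> real \<Rightarrow> complex) \<Rightarrow> (real \<Rightarrow> real \<Rightarrow> real) \<Rightarrow> bool" where
  "solves_system \<alpha> \<beta> u v \<longleftrightarrow>
    (\<exists>u_t u_x u_xx v_t v_x v_xx v_xxx v2_x m_x. \<forall>x t.
      ((\<lambda>s. u x s) has_vector_derivative u_t x t) (at t) \<and>
      ((\<lambda>y. u y t) has_vector_derivative u_x x t) (at x) \<and>
      ((\<lambda>y. u_x y t) has_vector_derivative u_xx x t) (at x) \<and>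
      ((\<lambda>s. v x s) has_real_derivative v_t x t) (at t) \<and>
      ((\<lambda>y. v y t) has_real_derivative v_x x t) (at x) \<and>
      ((\<lambda>y. v_x y t) has_real_derivative v_xx x t) (at x) \<and>
      ((\<lambda>y. v_xx y t) has_real_derivative v_xxx x t) (at x) \<and>
      ((\<lambda>y. (v y t)\<^sup>2) has_real_derivative v2_x x t) (at x) \<and>
      ((\<lambda>y. (cmod (u y t))\<^sup>2) has_real_derivative m_x x t) (at x) \<and>
      \<i> * u_t x t + u_xx x t + u x t * complex_of_real (v x t) = 0 \<and>
      v_t x t + v_x x t + \<beta> * v2_x x t + \<alpha> * v_xxx x t = - (1/2) * m_x x t)"

definition wave_u :: "real \<Rightarrow> real \<Rightarrow> (real \<Rightarrow> real) \<Rightarrow> real \<Rightarrow> real \<Rightarrow> complex" where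
  "wave_u \<omega> c \<phi> x t =
     exp (\<i> * complex_of_real (\<omega> * t)) * exp (\<i> * complex_of_real (c / 2 * (x - c * t)))
       * complex_of_real (\<phi> (x - c * t))"

definition wave_v :: "real \<Rightarrow> (real \<Rightarrow> real) \<Rightarrow> real \<Rightarrow> real \<Rightarrow> real" where
  "wave_v c \<psi> x t = \<psi> (x - c * t)"

definition solves_profile ::
    "real \<Rightarrow> real \<Rightarrow> real \<Rightarrow> real \<Rightarrow> (real \<Rightarrow> real) \<Rightarrow> (real \<Rightarrow> real) \<Rightarrow> bool" where
  "solves_profile c \<sigma> \<alpha> \<beta> \<phi> \<psi> \<longleftrightarrow>
    (\<exists>\<phi>1 \<phi>2 \<psi>1 \<psi>2 \<psi>3 m1. \<forall>x.
      (\<phi> has_real_derivative \<phi>1 x) (at x) \<and>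
      (\<phi>1 has_real_derivative \<phi>2 x) (at x) \<and>
      (\<psi> has_real_derivative \<psi>1 x) (at x) \<and>
      (\<psi>1 has_real_derivative \<psi>2 x) (at x) \<and>
      (\<psi>2 has_real_derivative \<psi>3 x) (at x) \<and>
      ((\<lambda>y. (\<phi> y)\<^sup>2) has_real_derivative m1 x) (at x) \<and>
      \<phi>2 x - \<sigma> * \<phi> x + \<phi> x * \<psi> x = 0 \<and>
      - c * \<psi>1 x + \<psi>1 x + 2 * \<beta> * \<psi> x * \<psi>1 x + \<alpha> * \<psi>3 x = - (1/2) * m1 x)"

definition solves_integrated_profile ::
    "real \<Rightarrow> real \<Rightarrow> real \<Rightarrow> real \<Rightarrow> real \<Rightarrow> (real \<Rightarrow> real) \<Rightarrow> (real \<Rightarrow> real) \<Rightarrow> bool" where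
  "solves_integrated_profile c \<sigma> \<alpha> \<beta> b \<phi> \<psi> \<longleftrightarrow>
    (\<exists>\<phi>1 \<phi>2 \<psi>1 \<psi>2. \<forall>x.
      (\<phi> has_real_derivative \<phi>1 x) (at x) \<and>
      (\<phi>1 has_real_derivative \<phi>2 x) (at x) \<and>
      (\<psi> has_real_derivative \<psi>1 x) (at x) \<and>
      (\<psi>1 has_real_derivative \<psi>2 x) (at x) \<and>
      \<phi>2 x - \<sigma> * \<phi> x + \<phi> x * \<psi> x = 0 \<and>
      - c * \<psi> x + \<psi> x + \<beta> * (\<psi> x)\<^sup>2 + \<alpha> * \<psi>2 x + (1/2) * (\<phi> x)\<^sup>2 = b)"

end

theory Submission
  imports Defs
begin

text \<open>
  The incomplete integral \<open>F\<close> has derivative \<open>1 / \<surd>(1 - \<kappa>\<^sup>2 sin\<^sup>2) \<ge> 1\<close>, so it is an expanding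
  bijection of the line and its inverse \<open>am\<close> satisfies \<open>am' = dn\<close>. This gives
  \<open>dn'' = (2 - \<kappa>\<^sup>2) dn - 2 dn\<^sup>3\<close> and \<open>dn'\<^sup>2 = (1 - dn\<^sup>2) (dn\<^sup>2 - (1 - \<kappa>\<^sup>2))\<close>, after which the profile
  equations reduce to comparing coefficients of powers of \<open>dn\<close>. Periodicity follows from
  \<open>F (\<theta> + \<pi>) = F \<theta> + 2 K\<close>. The system for a travelling wave reduces to the profile equations because
  the oscillating factor never vanishes and the profile can be recovered as the real part
  of the demodulated wave at time 0.
\<close>

section \<open>Jacobi elliptic functions\<close>

lemma modulus_radicand_pos:
  fixes \<kappa> s :: real
  assumes "\<bar>\<kappa>\<bar> < 1"
  shows "1 - \<kappa>\<^sup>2 * (sin s)\<^sup>2 > 0"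
proof -
  have "\<kappa>\<^sup>2 < 1" using assms by (simp add: abs_square_less_1)
  moreover have "(sin s)\<^sup>2 \<le> 1" by (simp add: abs_square_le_1)
  ultimately have "\<kappa>\<^sup>2 * (sin s)\<^sup>2 \<le> \<kappa>\<^sup>2 * 1"
    by (intro mult_left_mono) auto
  with \<open>\<kappa>\<^sup>2 < 1\<close> show ?thesis by simp
qed

lemma has_real_derivative_ellip_F:
  assumes "\<bar>\<kappa>\<bar> < 1"
  shows "((\<lambda>\<theta>. ellip_F \<theta> \<kappa>) has_real_derivative 1 / sqrt (1 - \<kappa>\<^sup>2 * (sin \<theta>)\<^sup>2)) (at \<theta>)"
proof -
  \<comment> \<open>The margin 1 puts \<theta> in the interior of [-R, R], which also contains the
    base point 0. The one-sided form of the fundamental theorem thus becomes a two-sided derivative,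
    for either sign of \<theta>.\<close>
  define R where "R = \<bar>\<theta>\<bar> + 1"
  let ?f = "\<lambda>s. 1 / sqrt (1 - \<kappa>\<^sup>2 * (sin s)\<^sup>2)"
  have "1 - \<kappa>\<^sup>2 * (sin s)\<^sup>2 \<noteq> 0" for s
    using modulus_radicand_pos[OF assms, of s] by simp
  then have cont: "continuous_on {-R..R} ?f"
    by (intro continuous_intros) (auto simp del: right_minus_eq)
  have "((\<lambda>u. LBINT y=ereal 0..ereal u. ?f y) has_vector_derivative ?f \<theta>) (at \<theta> within {-R..R})"
    by (rule interval_integral_FTC2[OF _ _ cont]) (auto simp: R_def)
  moreover have "\<theta> \<in> interior {-R..R}" by (auto simp: R_def)
  ultimately show ?thesis
    unfolding ellip_F_def has_real_derivative_iff_has_vector_derivative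
    by (metis at_within_interior)
qed

lemma ellip_F_0 [simp]: "ellip_F 0 \<kappa> = 0"
  by (simp add: ellip_F_def)

text \<open>Since the integrand is at least 1, \<open>ellip_F x \<kappa> - x\<close> is
  nondecreasing. This one estimate yields injectivity, surjectivity, continuity of the inverse and
  positivity of K.\<close>

lemma ellip_F_expanding:
  assumes "\<bar>\<kappa>\<bar> < 1" and "a \<le> b"
  shows "b - a \<le> ellip_F b \<kappa> - ellip_F a \<kappa>"
proof -
  have "ellip_F a \<kappa> - a \<le> ellip_F b \<kappa> - b"
  proof (rule DERIV_nonneg_imp_nondecreasing[OF assms(2)])
    fix x
    have "1 - \<kappa>\<^sup>2 * (sin x)\<^sup>2 \<le> 1" by simp
    then have "sqrt (1 - \<kappa>\<^sup>2 * (sin x)\<^sup>2) \<le> 1" by simp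
    then have "1 / sqrt (1 - \<kappa>\<^sup>2 * (sin x)\<^sup>2) - 1 \<ge> 0"
      using modulus_radicand_pos[OF assms(1), of x] by (simp add: field_simps)
    moreover have "((\<lambda>x. ellip_F x \<kappa> - x) has_real_derivative
        1 / sqrt (1 - \<kappa>\<^sup>2 * (sin x)\<^sup>2) - 1) (at x)"
      by (intro derivative_intros has_real_derivative_ellip_F assms)
    ultimately show "\<exists>y. ((\<lambda>x. ellip_F x \<kappa> - x) has_real_derivative y) (at x) \<and> y \<ge> 0"
      by blast
  qed
  then show ?thesis by simp
qed

lemma ellip_F_dist:
  assumes "\<bar>\<kappa>\<bar> < 1"
  shows "\<bar>a - b\<bar> \<le> \<bar>ellip_F a \<kappa> - ellip_F b \<kappa>\<bar>"
proof (cases "a \<le> b")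
  case True
  then show ?thesis using ellip_F_expanding[OF assms, of a b] by simp
next
  case False
  then show ?thesis using ellip_F_expanding[OF assms, of b a] by simp
qed

lemma ellip_F_surj:
  assumes "\<bar>\<kappa>\<bar> < 1"
  shows "\<exists>\<theta>. ellip_F \<theta> \<kappa> = x"
proof -
  \<comment> \<open>Expansion from the base point 0 gives F(-|x|) \<le> -|x| \<le> x \<le> |x| \<le>
    F(|x|), so this interval brackets a preimage.\<close>
  have "\<exists>\<theta>. - \<bar>x\<bar> \<le> \<theta> \<and> \<theta> \<le> \<bar>x\<bar> \<and> ellip_F \<theta> \<kappa> = x"
  proof (rule IVT)
    show "ellip_F (- \<bar>x\<bar>) \<kappa> \<le> x"
      using ellip_F_expanding[OF assms, of "- \<bar>x\<bar>" 0] unfolding ellip_F_0 by linarith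
    show "x \<le> ellip_F \<bar>x\<bar> \<kappa>"
      using ellip_F_expanding[OF assms, of 0 "\<bar>x\<bar>"] unfolding ellip_F_0 by linarith
    show "\<forall>\<theta>. - \<bar>x\<bar> \<le> \<theta> \<and> \<theta> \<le> \<bar>x\<bar> \<longrightarrow> isCont (\<lambda>\<theta>. ellip_F \<theta> \<kappa>) \<theta>"
      using DERIV_isCont[OF has_real_derivative_ellip_F[OF assms]] by blast
  qed simp
  then show ?thesis by blast
qed

lemma ellip_F_jacobi_am:
  assumes "\<bar>\<kappa>\<bar> < 1"
  shows "ellip_F (jacobi_am x \<kappa>) \<kappa> = x"
proof -
  obtain \<theta> where "ellip_F \<theta> \<kappa> = x" using ellip_F_surj[OF assms] by blast
  moreover have "\<theta>' = \<theta>" if "ellip_F \<theta>' \<kappa> = x" for \<theta>'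
    using ellip_F_dist[OF assms, of \<theta>' \<theta>] that calculation by simp
  ultimately have "\<exists>!\<theta>. ellip_F \<theta> \<kappa> = x" by (rule ex1I)
  then show ?thesis unfolding jacobi_am_def by (rule theI')
qed

lemma jacobi_am_ellip_F:
  assumes "\<bar>\<kappa>\<bar> < 1"
  shows "jacobi_am (ellip_F \<theta> \<kappa>) \<kappa> = \<theta>"
  using ellip_F_dist[OF assms, of "jacobi_am (ellip_F \<theta> \<kappa>) \<kappa>" \<theta>]
  by (simp add: ellip_F_jacobi_am[OF assms])

lemma has_real_derivative_jacobi_am:
  assumes "\<bar>\<kappa>\<bar> < 1"
  shows "((\<lambda>x. jacobi_am x \<kappa>) has_real_derivative jacobi_dn x \<kappa>) (at x)"
proof -
  let ?D = "sqrt (1 - \<kappa>\<^sup>2 * (sin (jacobi_am x \<kappa>))\<^sup>2)"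
  \<comment> \<open>Expansion of F read backwards: am is 1-Lipschitz. This supplies the continuity
    that the inverse function rule demands.\<close>
  have "dist (jacobi_am y \<kappa>) (jacobi_am x \<kappa>) \<le> dist y x" for y
    using ellip_F_dist[OF assms, of "jacobi_am y \<kappa>" "jacobi_am x \<kappa>"]
    by (simp add: dist_real_def ellip_F_jacobi_am[OF assms])
  then have "isCont (\<lambda>x. jacobi_am x \<kappa>) x"
    unfolding continuous_at_eps_delta by (meson le_less_trans)
  then have "((\<lambda>x. jacobi_am x \<kappa>) has_real_derivative inverse (1 / ?D)) (at x)"
    using modulus_radicand_pos[OF assms, of "jacobi_am x \<kappa>"]
    by (intro DERIV_inverse_function[where f = "\<lambda>\<theta>. ellip_F \<theta> \<kappa>" and a = "x - 1" and b = "x + 1"]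
        has_real_derivative_ellip_F assms ellip_F_jacobi_am) auto
  then show ?thesis by (simp add: jacobi_dn_def jacobi_sn_def)
qed

section \<open>Differential equations for dn\<close>

lemma jacobi_dn_pos:
  assumes "\<bar>\<kappa>\<bar> < 1"
  shows "jacobi_dn x \<kappa> > 0"
  using modulus_radicand_pos[OF assms] by (simp add: jacobi_dn_def jacobi_sn_def)

lemma jacobi_dn_squared:
  assumes "\<bar>\<kappa>\<bar> < 1"
  shows "(jacobi_dn x \<kappa>)\<^sup>2 = 1 - \<kappa>\<^sup>2 * (sin (jacobi_am x \<kappa>))\<^sup>2"
  using modulus_radicand_pos[OF assms, of "jacobi_am x \<kappa>"]
  by (simp add: jacobi_dn_def jacobi_sn_def)

text \<open>In classical notation this is -\<kappa>^2 sn cn, with cn written out as the cosine of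
  am.\<close>

definition jacobi_dn' :: "real \<Rightarrow> real \<Rightarrow> real" where
  "jacobi_dn' x \<kappa> = - \<kappa>\<^sup>2 * sin (jacobi_am x \<kappa>) * cos (jacobi_am x \<kappa>)"

lemma has_real_derivative_jacobi_dn:
  assumes "\<bar>\<kappa>\<bar> < 1"
  shows "((\<lambda>x. jacobi_dn x \<kappa>) has_real_derivative jacobi_dn' x \<kappa>) (at x)"
proof -
  let ?D = "\<lambda>x. 1 - \<kappa>\<^sup>2 * (sin (jacobi_am x \<kappa>))\<^sup>2"
  \<comment> \<open>The derivative of dn^2 is put in the form 2 dn' dn, so that the factor 1 / (2
    dn) from the square root cancels.\<close>
  have "(?D has_real_derivative 2 * jacobi_dn' x \<kappa> * jacobi_dn x \<kappa>) (at x)"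
    by (rule derivative_eq_intros has_real_derivative_jacobi_am[OF assms] refl)+
      (simp add: jacobi_dn'_def)
  then have "((\<lambda>x. sqrt (?D x)) has_real_derivative
      inverse (sqrt (?D x)) / 2 * (2 * jacobi_dn' x \<kappa> * jacobi_dn x \<kappa>)) (at x)"
    by (intro DERIV_chain2[where f = sqrt and g = ?D] DERIV_real_sqrt modulus_radicand_pos assms)
  moreover have "inverse (jacobi_dn x \<kappa>) / 2 * (2 * jacobi_dn' x \<kappa> * jacobi_dn x \<kappa>) = jacobi_dn' x \<kappa>"
    using jacobi_dn_pos[OF assms, of x] by simp
  ultimately show ?thesis by (simp only: jacobi_dn_def jacobi_sn_def)
qed

text \<open>The two factors are \<kappa>^2 sin^2 and \<kappa>^2 cos^2 of am, written through dn. The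
  identity later removes dn'^2 from the second derivative of dn^2.\<close>

lemma jacobi_dn'_squared:
  assumes "\<bar>\<kappa>\<bar> < 1"
  shows "(jacobi_dn' x \<kappa>)\<^sup>2 = (1 - (jacobi_dn x \<kappa>)\<^sup>2) * ((jacobi_dn x \<kappa>)\<^sup>2 - (1 - \<kappa>\<^sup>2))"
  unfolding jacobi_dn_squared[OF assms] jacobi_dn'_def
  by (simp add: power_mult_distrib cos_squared_eq) algebra

text \<open>Differentiating sin cos along am' = dn produces (cos^2 - sin^2) dn. Both squares are
  expressible through dn^2, so the equation closes in dn alone.\<close>

lemma has_real_derivative_jacobi_dn':
  assumes "\<bar>\<kappa>\<bar> < 1"
  shows "((\<lambda>x. jacobi_dn' x \<kappa>) has_real_derivative
    (2 - \<kappa>\<^sup>2) * jacobi_dn x \<kappa> - 2 * (jacobi_dn x \<kappa>) ^ 3) (at x)"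
proof -
  let ?s = "sin (jacobi_am x \<kappa>)" and ?c = "cos (jacobi_am x \<kappa>)" and ?d = "jacobi_dn x \<kappa>"
  have "((\<lambda>x. jacobi_dn' x \<kappa>) has_real_derivative - \<kappa>\<^sup>2 * (?c\<^sup>2 - ?s\<^sup>2) * ?d) (at x)"
    unfolding jacobi_dn'_def
    by (rule derivative_eq_intros has_real_derivative_jacobi_am[OF assms] refl)+
      (simp add: algebra_simps power2_eq_square)
  moreover have "- \<kappa>\<^sup>2 * (?c\<^sup>2 - ?s\<^sup>2) = 2 - \<kappa>\<^sup>2 - 2 * ?d\<^sup>2"
    unfolding jacobi_dn_squared[OF assms] by (simp add: cos_squared_eq algebra_simps)
  ultimately have "((\<lambda>x. jacobi_dn' x \<kappa>) has_real_derivative (2 - \<kappa>\<^sup>2 - 2 * ?d\<^sup>2) * ?d) (at x)"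
    by metis
  then show ?thesis
    by (simp add: algebra_simps power2_eq_square power3_eq_cube)
qed

section \<open>Symmetries of F and the period of dn\<close>

lemma ellip_F_minus:
  assumes "\<bar>\<kappa>\<bar> < 1"
  shows "ellip_F (- \<theta>) \<kappa> = - ellip_F \<theta> \<kappa>"
proof -
  let ?G = "\<lambda>\<theta>. ellip_F (- \<theta>) \<kappa> + ellip_F \<theta> \<kappa>"
  have "(?G has_real_derivative 0) (at x)" for x
    by (rule derivative_eq_intros refl has_real_derivative_ellip_F[OF assms]
        DERIV_chain2[OF has_real_derivative_ellip_F[OF assms], where g = uminus])+ simp
  then have "?G \<theta> = ?G 0" by (intro DERIV_isconst_all) auto
  then show ?thesis by simp
qed

text \<open>The integrand has period pi because sin^2 does, so the increment of F over a shift by pi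
  is constant.\<close>

lemma ellip_F_add_pi:
  assumes "\<bar>\<kappa>\<bar> < 1"
  shows "ellip_F (\<theta> + pi) \<kappa> = ellip_F \<theta> \<kappa> + 2 * ellip_K \<kappa>"
proof -
  let ?G = "\<lambda>\<theta>. ellip_F (\<theta> + pi) \<kappa> - ellip_F \<theta> \<kappa>"
  have "(?G has_real_derivative 0) (at x)" for x
    by (rule derivative_eq_intros refl has_real_derivative_ellip_F[OF assms]
        DERIV_chain2[OF has_real_derivative_ellip_F[OF assms], where g = "\<lambda>x. x + pi"])+ simp
  \<comment> \<open>At -pi/2 the increment is F(pi/2) - F(-pi/2), which is 2K by oddness.\<close>
  then have "?G \<theta> = ?G (- (pi / 2))" by (intro DERIV_isconst_all) auto
  then show ?thesis by (simp add: ellip_F_minus[OF assms] ellip_K_def)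
qed

text \<open>A shift by 2K adds pi to am. This flips the sign of sn, which enters dn only through its
  square.\<close>

lemma jacobi_dn_add_2K:
  assumes "\<bar>\<kappa>\<bar> < 1"
  shows "jacobi_dn (x + 2 * ellip_K \<kappa>) \<kappa> = jacobi_dn x \<kappa>"
proof -
  have "jacobi_am (x + 2 * ellip_K \<kappa>) \<kappa> = jacobi_am x \<kappa> + pi"
    using jacobi_am_ellip_F[OF assms, of "jacobi_am x \<kappa> + pi"]
    by (simp add: ellip_F_add_pi[OF assms] ellip_F_jacobi_am[OF assms])
  then show ?thesis by (simp add: jacobi_dn_def jacobi_sn_def)
qed

lemma ellip_K_pos:
  assumes "\<bar>\<kappa>\<bar> < 1"
  shows "ellip_K \<kappa> > 0"
  using ellip_F_expanding[OF assms, of 0 "pi / 2"] pi_gt_zero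
  unfolding ellip_K_def ellip_F_0 by linarith

section \<open>Reduction of travelling waves to profiles\<close>

definition carrier_wave :: "real \<Rightarrow> real \<Rightarrow> real \<Rightarrow> real \<Rightarrow> complex" where
  "carrier_wave \<omega> c x t =
     exp (\<i> * complex_of_real (\<omega> * t)) * exp (\<i> * complex_of_real (c / 2 * (x - c * t)))"

lemma wave_u_carrier: "wave_u \<omega> c f x t = carrier_wave \<omega> c x t * of_real (f (x - c * t))"
  by (simp add: wave_u_def carrier_wave_def)

lemma carrier_wave_neq_0 [simp]: "carrier_wave \<omega> c x t \<noteq> 0"
  by (simp add: carrier_wave_def)

lemma cmod_wave_u: "cmod (wave_u \<omega> c f x t) = \<bar>f (x - c * t)\<bar>"
  by (simp add: wave_u_def norm_mult)

text \<open>Collecting the phase makes it affine in x for fixed t and in t for fixed x, so one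
  derivative rule serves both variables.\<close>

lemma carrier_wave_alt:
  "carrier_wave \<omega> c x t = exp (of_real (c / 2 * x + (\<omega> - c\<^sup>2 / 2) * t) * \<i>)"
  unfolding carrier_wave_def
  by (simp add: exp_add[symmetric] field_simps power2_eq_square)

lemma has_vector_derivative_exp_i_affine:
  fixes a b x :: real
  shows "((\<lambda>y. exp (of_real (a * y + b) * \<i>)) has_vector_derivative
    exp (of_real (a * x + b) * \<i>) * (\<i> * of_real a)) (at x)"
proof -
  let ?f = "\<lambda>z. exp ((of_real a * z + of_real b) * \<i>)"
  have "(?f has_field_derivative ?f (of_real x) * (\<i> * of_real a)) (at (of_real x))"
    by (auto intro!: derivative_eq_intros)
  from has_vector_derivative_real_field[OF this] show ?thesis by simp
qed

text \<open>The profile \<open>h\<close> is complex so that the rule can be iterated: one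
  x-derivative turns f into f' + i (c/2) f. It is also used with -c for c, to remove the oscillation
  from a general complex function.\<close>

lemma has_vector_derivative_modulated_x:
  fixes h :: "real \<Rightarrow> complex"
  assumes "(h has_vector_derivative h') (at (x - c * t))"
  shows "((\<lambda>y. carrier_wave \<omega> c y t * h (y - c * t)) has_vector_derivative
    carrier_wave \<omega> c x t * (h' + \<i> * of_real (c / 2) * h (x - c * t))) (at x)"
proof -
  have "((\<lambda>y. h (y - c * t)) has_vector_derivative 1 *\<^sub>R h') (at x)"
    using vector_diff_chain_at[of "\<lambda>y. y - c * t" 1 x h h'] assms
    unfolding o_def by (fastforce intro!: derivative_eq_intros)
  moreover have "((\<lambda>y. carrier_wave \<omega> c y t) has_vector_derivative
      carrier_wave \<omega> c x t * (\<i> * of_real (c / 2))) (at x)"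
    unfolding carrier_wave_alt by (rule has_vector_derivative_exp_i_affine)
  ultimately show ?thesis
    by (auto intro!: derivative_eq_intros simp: algebra_simps)
qed

lemma has_vector_derivative_modulated_t:
  fixes h :: "real \<Rightarrow> complex"
  assumes "(h has_vector_derivative h') (at (x - c * t))"
  shows "((\<lambda>s. carrier_wave \<omega> c x s * h (x - c * s)) has_vector_derivative
    carrier_wave \<omega> c x t * (\<i> * of_real (\<omega> - c\<^sup>2 / 2) * h (x - c * t) - of_real c * h')) (at t)"
proof -
  have "((\<lambda>s. h (x - c * s)) has_vector_derivative (- c) *\<^sub>R h') (at t)"
    using vector_diff_chain_at[of "\<lambda>s. x - c * s" "- c" t h h'] assms
    unfolding o_def by (fastforce intro!: derivative_eq_intros)
  moreover have "((\<lambda>s. carrier_wave \<omega> c x s) has_vector_derivative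
      carrier_wave \<omega> c x t * (\<i> * of_real (\<omega> - c\<^sup>2 / 2))) (at t)"
    unfolding carrier_wave_alt add.commute[of "c / 2 * x"]
    by (rule has_vector_derivative_exp_i_affine)
  ultimately show ?thesis
    by (auto intro!: derivative_eq_intros simp: algebra_simps scaleR_conv_of_real)
qed

text \<open>At time 0 the factor with -c is exp(-i c x / 2), the inverse of the carrier.
  Differentiability of the wave can thus be passed on to its real profile.\<close>

lemma has_real_derivative_demodulated:
  fixes w :: "real \<Rightarrow> complex"
  assumes "(w has_vector_derivative w') (at x)"
  shows "((\<lambda>y. Re (carrier_wave \<omega> (- c) y 0 * w y)) has_real_derivative
    Re (carrier_wave \<omega> (- c) x 0 * (w' - \<i> * of_real (c / 2) * w x))) (at x)"
proof -
  have "((\<lambda>y. carrier_wave \<omega> (- c) y 0 * w y) has_vector_derivative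
      carrier_wave \<omega> (- c) x 0 * (w' - \<i> * of_real (c / 2) * w x)) (at x)"
    using has_vector_derivative_modulated_x[of w w' x "- c" 0 \<omega>] assms by simp
  then show ?thesis
    unfolding has_real_derivative_iff_has_vector_derivative
    by (rule bounded_linear.has_vector_derivative[OF bounded_linear_Re])
qed

lemma carrier_wave_demodulate: "carrier_wave \<omega> (- c) x 0 * carrier_wave \<omega> c x 0 = 1"
  by (simp add: carrier_wave_alt flip: exp_add)

lemma has_vector_derivative_complex_of_real:
  assumes "(f has_real_derivative f') (at x)"
  shows "((\<lambda>x. complex_of_real (f x)) has_vector_derivative of_real f') (at x)"
  using assms unfolding has_real_derivative_iff_has_vector_derivative
  by (rule bounded_linear.has_vector_derivative[OF bounded_linear_of_real])

lemma wave_u_derivatives: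
  fixes f f1 f2 :: "real \<Rightarrow> real" and \<omega> c :: real
  assumes f1: "\<And>x. (f has_real_derivative f1 x) (at x)"
    and f2: "\<And>x. (f1 has_real_derivative f2 x) (at x)"
  defines "ux \<equiv> \<lambda>x t. carrier_wave \<omega> c x t *
    (of_real (f1 (x - c * t)) + \<i> * of_real (c / 2) * of_real (f (x - c * t)))"
  shows "((\<lambda>s. wave_u \<omega> c f x s) has_vector_derivative carrier_wave \<omega> c x t *
      (\<i> * of_real (\<omega> - c\<^sup>2 / 2) * of_real (f (x - c * t)) - of_real c * of_real (f1 (x - c * t))))
      (at t)" (is ?t)
    and "((\<lambda>y. wave_u \<omega> c f y t) has_vector_derivative ux x t) (at x)" (is ?x)
    and "((\<lambda>y. ux y t) has_vector_derivative carrier_wave \<omega> c x t *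
      (of_real (f2 (x - c * t)) + \<i> * of_real (c / 2) * of_real (f1 (x - c * t))
        + \<i> * of_real (c / 2) *
          (of_real (f1 (x - c * t)) + \<i> * of_real (c / 2) * of_real (f (x - c * t))))) (at x)" (is ?xx)
proof -
  note df = has_vector_derivative_complex_of_real[OF f1]
  show ?t unfolding wave_u_carrier by (rule has_vector_derivative_modulated_t[OF df])
  show ?x unfolding wave_u_carrier ux_def by (rule has_vector_derivative_modulated_x[OF df])
  show ?xx unfolding ux_def
    by (rule has_vector_derivative_modulated_x[
          where h = "\<lambda>z. of_real (f1 z) + \<i> * of_real (c / 2) * of_real (f z)"])
      (intro has_vector_derivative_add has_vector_derivative_mult_right df
        has_vector_derivative_complex_of_real[OF f2])
qed

text \<open>The wave number c/2 makes the \<open>p1\<close> terms cancel: -i c + 2 i (c/2) = 0. The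
  coefficient of \<open>p\<close> is -(\<omega> - c^2/2) - c^2/4, which is the origin of
  \<sigma>.\<close>

lemma schroedinger_carrier:
  fixes E :: complex and p p1 p2 q \<omega> c :: real
  shows "\<i> * (E * (\<i> * of_real (\<omega> - c\<^sup>2 / 2) * of_real p - of_real c * of_real p1))
    + E * (of_real p2 + \<i> * of_real (c / 2) * of_real p1
        + \<i> * of_real (c / 2) * (of_real p1 + \<i> * of_real (c / 2) * of_real p))
    + E * of_real p * of_real q = E * of_real (p2 - (\<omega> - c\<^sup>2 / 4) * p + p * q)"
proof -
  have i: "\<i> * (\<i> * z) = - z" for z by (simp flip: mult.assoc)
  show ?thesis by (simp add: i field_simps power2_eq_square)
qed

section \<open>Equivalence of the system and the profile equations\<close>

lemma has_real_derivative_shift_x: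
  fixes g :: "real \<Rightarrow> real"
  assumes "(g has_real_derivative g') (at (x - c * t))"
  shows "((\<lambda>y. g (y - c * t)) has_real_derivative g') (at x)"
proof -
  have "((\<lambda>y. y - c * t) has_real_derivative 1) (at x)" by (auto intro!: derivative_eq_intros)
  from DERIV_chain2[where f = g and g = "\<lambda>y. y - c * t", OF assms this] show ?thesis by simp
qed

lemma has_real_derivative_shift_t:
  fixes g :: "real \<Rightarrow> real"
  assumes "(g has_real_derivative g') (at (x - c * t))"
  shows "((\<lambda>s. g (x - c * s)) has_real_derivative - c * g') (at t)"
proof -
  have "((\<lambda>s. x - c * s) has_real_derivative - c) (at t)" by (auto intro!: derivative_eq_intros)
  from DERIV_chain2[where f = g and g = "\<lambda>s. x - c * s", OF assms this] show ?thesis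
    by (simp add: mult.commute)
qed

lemma solves_system_wave_if_solves_profile:
  assumes "solves_profile c (\<omega> - c\<^sup>2 / 4) \<alpha> \<beta> f g"
  shows "solves_system \<alpha> \<beta> (wave_u \<omega> c f) (wave_v c g)"
proof -
  obtain f1 f2 g1 g2 g3 m1 where
    f1: "\<And>x. (f has_real_derivative f1 x) (at x)" and
    f2: "\<And>x. (f1 has_real_derivative f2 x) (at x)" and
    g1: "\<And>x. (g has_real_derivative g1 x) (at x)" and
    g2: "\<And>x. (g1 has_real_derivative g2 x) (at x)" and
    g3: "\<And>x. (g2 has_real_derivative g3 x) (at x)" and
    m1: "\<And>x. ((\<lambda>y. (f y)\<^sup>2) has_real_derivative m1 x) (at x)" and
    eq1: "\<And>x. f2 x - (\<omega> - c\<^sup>2 / 4) * f x + f x * g x = 0" and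
    eq2: "\<And>x. - c * g1 x + g1 x + 2 * \<beta> * g x * g1 x + \<alpha> * g3 x = - (1/2) * m1 x"
    using assms unfolding solves_profile_def by blast
  have sq: "((\<lambda>y. (g y)\<^sup>2) has_real_derivative 2 * g x * g1 x) (at x)" for x
    by (auto intro!: derivative_eq_intros g1)
  have wave_eq: "- c * g1 x + g1 x + \<beta> * (2 * g x * g1 x) + \<alpha> * g3 x = - (1/2) * m1 x" for x
    using eq2[of x] by (simp add: mult_ac)
  note shift = has_real_derivative_shift_x[where c = c]
  show ?thesis
    \<comment> \<open>The nine derivative witnesses stay schematic and are fixed by unification with
      the derivative rules; what then remains are the two differential equations.\<close>
    unfolding solves_system_def
    by (rule exI)+
      (intro allI conjI,
        rule wave_u_derivatives[OF f1 f2], rule wave_u_derivatives[OF f1 f2], rule wave_u_derivatives[OF f1 f2],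
        unfold wave_v_def cmod_wave_u power2_abs,
        unfold wave_u_carrier schroedinger_carrier eq1,
        (rule has_real_derivative_shift_t[OF g1] shift[OF g1] shift[OF g2] shift[OF g3]
          shift[OF sq] shift[OF m1])+,
        simp, rule wave_eq)
qed

text \<open>Regularity is given only for the waves, so differentiability of \<open>f\<close> is
  first recovered by demodulation at time 0. Uniqueness of derivatives then identifies the given
  witnesses with the computed ones.\<close>

lemma solves_profile_if_solves_system_wave:
  assumes "solves_system \<alpha> \<beta> (wave_u \<omega> c f) (wave_v c g)"
  shows "solves_profile c (\<omega> - c\<^sup>2 / 4) \<alpha> \<beta> f g"
proof -
  obtain ut ux uxx vt vx vxx vxxx v2x mx where
    ut: "\<And>x t. ((\<lambda>s. wave_u \<omega> c f x s) has_vector_derivative ut x t) (at t)" and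
    ux: "\<And>x t. ((\<lambda>y. wave_u \<omega> c f y t) has_vector_derivative ux x t) (at x)" and
    uxx: "\<And>x t. ((\<lambda>y. ux y t) has_vector_derivative uxx x t) (at x)" and
    vt: "\<And>x t. ((\<lambda>s. wave_v c g x s) has_real_derivative vt x t) (at t)" and
    vx: "\<And>x t. ((\<lambda>y. wave_v c g y t) has_real_derivative vx x t) (at x)" and
    vxx: "\<And>x t. ((\<lambda>y. vx y t) has_real_derivative vxx x t) (at x)" and
    vxxx: "\<And>x t. ((\<lambda>y. vxx y t) has_real_derivative vxxx x t) (at x)" and
    v2x: "\<And>x t. ((\<lambda>y. (wave_v c g y t)\<^sup>2) has_real_derivative v2x x t) (at x)" and
    mx: "\<And>x t. ((\<lambda>y. (cmod (wave_u \<omega> c f y t))\<^sup>2) has_real_derivative mx x t) (at x)" and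
    eq1: "\<And>x t. \<i> * ut x t + uxx x t + wave_u \<omega> c f x t * of_real (wave_v c g x t) = 0" and
    eq2: "\<And>x t. vt x t + vx x t + \<beta> * v2x x t + \<alpha> * vxxx x t = - (1/2) * mx x t"
    using assms unfolding solves_system_def by blast
  \<comment> \<open>Demodulating u_x gives f' + i (c/2) f, whose real part is f'; \<open>f2\<close>
    is the derivative of \<open>f1\<close> by the same rule.\<close>
  define f1 where "f1 x = Re (carrier_wave \<omega> (- c) x 0 * ux x 0)" for x
  define f2 where "f2 x = Re (carrier_wave \<omega> (- c) x 0 *
    (uxx x 0 - \<i> * of_real (c / 2) * ux x 0))" for x
  have dem: "carrier_wave \<omega> (- c) x 0 * wave_u \<omega> c f x 0 = of_real (f x)" for x
    by (simp add: wave_u_carrier carrier_wave_demodulate flip: mult.assoc)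
  have f1: "(f has_real_derivative f1 x) (at x)" for x
  proof -
    \<comment> \<open>The correction term is purely imaginary because \<open>f\<close> is real, so
      it vanishes in the real part.\<close>
    have "carrier_wave \<omega> (- c) x 0 * (ux x 0 - \<i> * of_real (c / 2) * wave_u \<omega> c f x 0)
        = carrier_wave \<omega> (- c) x 0 * ux x 0 - \<i> * of_real (c / 2) * of_real (f x)"
      unfolding dem[symmetric] by (simp add: algebra_simps)
    then show ?thesis
      using has_real_derivative_demodulated[OF ux[of 0 x], of \<omega> c] by (simp add: dem f1_def)
  qed
  have f2: "(f1 has_real_derivative f2 x) (at x)" for x
    using has_real_derivative_demodulated[OF uxx] unfolding f1_def f2_def .
  note deriv = wave_u_derivatives[where f = f and \<omega> = \<omega> and c = c, OF f1 f2]
  \<comment> \<open>Equality as functions is required here: \<open>uxx\<close> is the derivative of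
    \<open>ux\<close>, and must be compared with the third rule of \<open>deriv\<close>.\<close>
  have ux_eq: "ux = (\<lambda>x t. carrier_wave \<omega> c x t *
      (of_real (f1 (x - c * t)) + \<i> * of_real (c / 2) * of_real (f (x - c * t))))"
    by (intro ext vector_derivative_unique_at[OF ux deriv(2)])
  have g1: "(g has_real_derivative vx x 0) (at x)" for x
    using vx[of 0 x] by (simp add: wave_v_def)
  \<comment> \<open>At t = 0 the equation is the carrier times a real number. Keeping that number
    under a single \<open>of_real\<close> lets the nonzero carrier be cancelled and the equation be
    read in the reals.\<close>
  have "f2 x - (\<omega> - c\<^sup>2 / 4) * f x + f x * g x = 0" for x
    using eq1[of x 0] schroedinger_carrier[of "carrier_wave \<omega> c x 0" \<omega> c "f x" "f1 x" "f2 x" "g x"]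
      vector_derivative_unique_at[OF ut deriv(1), of x 0]
      vector_derivative_unique_at[OF uxx[unfolded ux_eq] deriv(3), of x 0]
    by (simp add: wave_u_carrier wave_v_def del: of_real_add of_real_diff of_real_mult of_real_divide)
  moreover have "vt x 0 = - c * vx x 0" for x
    using DERIV_unique[OF vt[of x 0, unfolded wave_v_def] has_real_derivative_shift_t] g1 by simp
  moreover have "v2x x 0 = 2 * g x * vx x 0" for x
  proof (rule DERIV_unique[OF v2x[of 0 x]])
    show "((\<lambda>y. (wave_v c g y 0)\<^sup>2) has_real_derivative 2 * g x * vx x 0) (at x)"
      by (auto intro!: derivative_eq_intros g1 simp: wave_v_def)
  qed
  ultimately show ?thesis
    unfolding solves_profile_def
    using f1 f2 g1 vxx[of 0] vxxx[of 0] mx[of 0, unfolded cmod_wave_u power2_abs] eq2[of _ 0]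
    by (intro exI[of _ f1] exI[of _ f2] exI[of _ "\<lambda>x. vx x 0"] exI[of _ "\<lambda>x. vxx x 0"]
        exI[of _ "\<lambda>x. vxxx x 0"] exI[of _ "\<lambda>x. mx x 0"]) (simp add: algebra_simps)
qed

section \<open>The dnoidal profiles\<close>

definition dnoidal :: "real \<Rightarrow> real \<Rightarrow> real \<Rightarrow> real \<Rightarrow> real" where
  "dnoidal \<phi>\<^sub>0 \<gamma> \<kappa> x = \<phi>\<^sub>0 * jacobi_dn (\<gamma> * x) \<kappa>"

lemma dnoidal_derivatives:
  assumes "\<bar>\<kappa>\<bar> < 1"
  shows "(dnoidal \<phi>\<^sub>0 \<gamma> \<kappa> has_real_derivative \<phi>\<^sub>0 * \<gamma> * jacobi_dn' (\<gamma> * x) \<kappa>) (at x)"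
    and "((\<lambda>x. \<phi>\<^sub>0 * \<gamma> * jacobi_dn' (\<gamma> * x) \<kappa>) has_real_derivative \<phi>\<^sub>0 * \<gamma>\<^sup>2 *
      ((2 - \<kappa>\<^sup>2) * jacobi_dn (\<gamma> * x) \<kappa> - 2 * (jacobi_dn (\<gamma> * x) \<kappa>) ^ 3)) (at x)"
proof -
  have lin: "((\<lambda>x. \<gamma> * x) has_real_derivative \<gamma>) (at x)"
    by (auto intro!: derivative_eq_intros)
  show "(dnoidal \<phi>\<^sub>0 \<gamma> \<kappa> has_real_derivative \<phi>\<^sub>0 * \<gamma> * jacobi_dn' (\<gamma> * x) \<kappa>) (at x)"
    unfolding dnoidal_def
    using DERIV_cmult[OF DERIV_chain2[OF has_real_derivative_jacobi_dn[OF assms] lin], of \<phi>\<^sub>0]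
    by (simp add: mult_ac)
  show "((\<lambda>x. \<phi>\<^sub>0 * \<gamma> * jacobi_dn' (\<gamma> * x) \<kappa>) has_real_derivative \<phi>\<^sub>0 * \<gamma>\<^sup>2 *
      ((2 - \<kappa>\<^sup>2) * jacobi_dn (\<gamma> * x) \<kappa> - 2 * (jacobi_dn (\<gamma> * x) \<kappa>) ^ 3)) (at x)"
    using DERIV_cmult[OF DERIV_chain2[OF has_real_derivative_jacobi_dn'[OF assms] lin], of "\<phi>\<^sub>0 * \<gamma>"]
    by (simp add: mult_ac power2_eq_square)
qed

text \<open>Eliminating dn'^2 makes the second derivative a polynomial in dn, so the third costs one
  more chain rule.\<close>

lemma dnoidal_squared_derivatives:
  fixes \<phi>\<^sub>0 \<gamma> \<kappa> :: real
  assumes "\<bar>\<kappa>\<bar> < 1"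
  defines "d \<equiv> \<lambda>x. jacobi_dn (\<gamma> * x) \<kappa>" and "d1 \<equiv> \<lambda>x. jacobi_dn' (\<gamma> * x) \<kappa>"
  shows "((\<lambda>x. (dnoidal \<phi>\<^sub>0 \<gamma> \<kappa> x)\<^sup>2) has_real_derivative 2 * \<phi>\<^sub>0\<^sup>2 * \<gamma> * (d x * d1 x)) (at x)" (is ?A)
    and "((\<lambda>x. 2 * \<phi>\<^sub>0\<^sup>2 * \<gamma> * (d x * d1 x)) has_real_derivative \<phi>\<^sub>0\<^sup>2 * \<gamma>\<^sup>2 *
      (4 * (2 - \<kappa>\<^sup>2) * (d x)\<^sup>2 - 6 * (d x) ^ 4 - 2 * (1 - \<kappa>\<^sup>2))) (at x)" (is ?B)
    and "((\<lambda>x. \<phi>\<^sub>0\<^sup>2 * \<gamma>\<^sup>2 * (4 * (2 - \<kappa>\<^sup>2) * (d x)\<^sup>2 - 6 * (d x) ^ 4 - 2 * (1 - \<kappa>\<^sup>2)))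
      has_real_derivative \<phi>\<^sub>0\<^sup>2 * \<gamma> ^ 3 * (8 * (2 - \<kappa>\<^sup>2) * d x - 24 * (d x) ^ 3) * d1 x) (at x)" (is ?C)
proof -
  have lin: "((\<lambda>x. \<gamma> * x) has_real_derivative \<gamma>) (at x)"
    by (auto intro!: derivative_eq_intros)
  have d: "(d has_real_derivative d1 x * \<gamma>) (at x)"
    unfolding d_def d1_def
    by (rule DERIV_chain2[OF has_real_derivative_jacobi_dn[OF assms(1)] lin])
  have d1: "(d1 has_real_derivative ((2 - \<kappa>\<^sup>2) * d x - 2 * (d x) ^ 3) * \<gamma>) (at x)"
    unfolding d_def d1_def
    by (rule DERIV_chain2[OF has_real_derivative_jacobi_dn'[OF assms(1)] lin])
  have sq: "(d1 x)\<^sup>2 = (1 - (d x)\<^sup>2) * ((d x)\<^sup>2 - (1 - \<kappa>\<^sup>2))"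
    unfolding d_def d1_def by (rule jacobi_dn'_squared[OF assms(1)])
  have "((\<lambda>x. (\<phi>\<^sub>0 * d x)\<^sup>2) has_real_derivative 2 * \<phi>\<^sub>0\<^sup>2 * \<gamma> * (d x * d1 x)) (at x)"
    by (auto intro!: derivative_eq_intros d simp: power2_eq_square)
  then show ?A by (simp add: dnoidal_def d_def)
  have "((\<lambda>x. 2 * \<phi>\<^sub>0\<^sup>2 * \<gamma> * (d x * d1 x)) has_real_derivative \<phi>\<^sub>0\<^sup>2 * \<gamma>\<^sup>2 *
      (2 * (d1 x)\<^sup>2 + 2 * d x * ((2 - \<kappa>\<^sup>2) * d x - 2 * (d x) ^ 3))) (at x)"
    by (rule derivative_eq_intros d d1 refl)+ (simp add: power2_eq_square algebra_simps)
  also have "2 * (d1 x)\<^sup>2 + 2 * d x * ((2 - \<kappa>\<^sup>2) * d x - 2 * (d x) ^ 3)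
      = 4 * (2 - \<kappa>\<^sup>2) * (d x)\<^sup>2 - 6 * (d x) ^ 4 - 2 * (1 - \<kappa>\<^sup>2)"
    unfolding sq by algebra
  finally show ?B .
  show ?C
    by (rule derivative_eq_intros d refl)+
      (simp add: power2_eq_square power3_eq_cube algebra_simps)
qed

text \<open>The relations are stated without division, for polynomial reasoning. In the first
  equation, \<sigma> matches the linear and \<open>A * \<phi>\<^sub>0\<^sup>2\<close> the cubic term
  in dn. In the integrated one, \<beta> = 3\<alpha> cancels the quartic terms, the value of
  \<open>\<phi>\<^sub>0\<^sup>2\<close> cancels the quadratic ones, and b is the constant left
  over.\<close>

lemma
  fixes \<alpha> \<beta> \<gamma> \<kappa> \<sigma> \<phi>\<^sub>0 c A :: real
  assumes \<kappa>: "\<bar>\<kappa>\<bar> < 1"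
    and \<beta>: "\<beta> = 3 * \<alpha>"
    and \<sigma>: "\<sigma> = \<gamma>\<^sup>2 * (2 - \<kappa>\<^sup>2)"
    and A: "A * \<phi>\<^sub>0\<^sup>2 = 2 * \<gamma>\<^sup>2"
    and \<phi>: "\<phi>\<^sub>0\<^sup>2 = 4 * \<gamma>\<^sup>2 * (c - 1 - 4 * \<alpha> * \<sigma>)"
  shows dnoidal_solves_profile:
      "solves_profile c \<sigma> \<alpha> \<beta> (dnoidal \<phi>\<^sub>0 \<gamma> \<kappa>) (\<lambda>x. A * (dnoidal \<phi>\<^sub>0 \<gamma> \<kappa> x)\<^sup>2)"
    and dnoidal_solves_integrated_profile:
      "solves_integrated_profile c \<sigma> \<alpha> \<beta> (- 4 * \<alpha> * (1 - \<kappa>\<^sup>2) * \<gamma> ^ 4)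
        (dnoidal \<phi>\<^sub>0 \<gamma> \<kappa>) (\<lambda>x. A * (dnoidal \<phi>\<^sub>0 \<gamma> \<kappa> x)\<^sup>2)"
proof -
  note deriv = dnoidal_derivatives[OF \<kappa>, of \<phi>\<^sub>0 \<gamma>] dnoidal_squared_derivatives[OF \<kappa>, of \<phi>\<^sub>0 \<gamma>]
  \<comment> \<open>The rules scaled by A differentiate \<psi>; the unscaled one still serves for
    the square of \<phi>.\<close>
  note cderiv = deriv(1,2) deriv(3-5)[THEN DERIV_cmult, of A]
  \<comment> \<open>With dn'^2 eliminated, the equations become identities in arbitrary reals
    \<open>d\<close> and \<open>e\<close> standing for dn and dn'.\<close>
  have eq1: "\<phi>\<^sub>0 * \<gamma>\<^sup>2 * ((2 - \<kappa>\<^sup>2) * d - 2 * d ^ 3) - \<sigma> * (\<phi>\<^sub>0 * d) + \<phi>\<^sub>0 * d * (A * (\<phi>\<^sub>0 * d)\<^sup>2) = 0" for d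
    using \<sigma> A by algebra
  have eq2: "- c * (A * (\<phi>\<^sub>0 * d)\<^sup>2) + A * (\<phi>\<^sub>0 * d)\<^sup>2 + \<beta> * (A * (\<phi>\<^sub>0 * d)\<^sup>2)\<^sup>2
      + \<alpha> * (A * (\<phi>\<^sub>0\<^sup>2 * \<gamma>\<^sup>2 * (4 * (2 - \<kappa>\<^sup>2) * d\<^sup>2 - 6 * d ^ 4 - 2 * (1 - \<kappa>\<^sup>2))))
      + 1 / 2 * (\<phi>\<^sub>0 * d)\<^sup>2 = - 4 * \<alpha> * (1 - \<kappa>\<^sup>2) * \<gamma> ^ 4" for d
  proof -
    \<comment> \<open>A is absorbed while the square of \<open>\<phi>\<^sub>0\<close> is still
      explicit; only afterwards are that square and \<sigma> replaced.\<close>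
    have A': "A * (\<phi>\<^sub>0 * d)\<^sup>2 = 2 * \<gamma>\<^sup>2 * d\<^sup>2" "A * (\<phi>\<^sub>0\<^sup>2 * \<gamma>\<^sup>2 * P) = 2 * \<gamma> ^ 4 * P" for P
      using A by algebra+
    show ?thesis
      unfolding A' \<beta> unfolding power_mult_distrib[of \<phi>\<^sub>0] \<phi> \<sigma> by algebra
  qed
  have eq3: "- c * (A * (2 * \<phi>\<^sub>0\<^sup>2 * \<gamma> * (d * e))) + A * (2 * \<phi>\<^sub>0\<^sup>2 * \<gamma> * (d * e))
      + 2 * \<beta> * (A * (\<phi>\<^sub>0 * d)\<^sup>2) * (A * (2 * \<phi>\<^sub>0\<^sup>2 * \<gamma> * (d * e)))
      + \<alpha> * (A * (\<phi>\<^sub>0\<^sup>2 * \<gamma> ^ 3 * (8 * (2 - \<kappa>\<^sup>2) * d - 24 * d ^ 3) * e))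
      = - (1 / 2) * (2 * \<phi>\<^sub>0\<^sup>2 * \<gamma> * (d * e))" for d e
  proof -
    have A': "A * (\<phi>\<^sub>0 * d)\<^sup>2 = 2 * \<gamma>\<^sup>2 * d\<^sup>2"
      "A * (2 * \<phi>\<^sub>0\<^sup>2 * \<gamma> * P) = 4 * \<gamma> ^ 3 * P" "A * (\<phi>\<^sub>0\<^sup>2 * \<gamma> ^ 3 * P * Q) = 2 * \<gamma> ^ 5 * P * Q" for P Q
      using A by algebra+
    show ?thesis
      unfolding A' \<beta> unfolding \<phi> \<sigma> by algebra
  qed
  show "solves_profile c \<sigma> \<alpha> \<beta> (dnoidal \<phi>\<^sub>0 \<gamma> \<kappa>) (\<lambda>x. A * (dnoidal \<phi>\<^sub>0 \<gamma> \<kappa> x)\<^sup>2)"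
    unfolding solves_profile_def
    by (rule exI)+ (intro allI conjI, (rule cderiv deriv)+,
        unfold dnoidal_def, (rule eq1 eq3)+)
  show "solves_integrated_profile c \<sigma> \<alpha> \<beta> (- 4 * \<alpha> * (1 - \<kappa>\<^sup>2) * \<gamma> ^ 4)
      (dnoidal \<phi>\<^sub>0 \<gamma> \<kappa>) (\<lambda>x. A * (dnoidal \<phi>\<^sub>0 \<gamma> \<kappa> x)\<^sup>2)"
    unfolding solves_integrated_profile_def
    by (rule exI)+ (intro allI conjI, (rule cderiv)+,
        unfold dnoidal_def, (rule eq1 eq2)+)
qed

lemma dnoidal_periodic:
  assumes "\<bar>\<kappa>\<bar> < 1" and "\<gamma> \<noteq> 0"
  shows "dnoidal \<phi>\<^sub>0 \<gamma> \<kappa> (x + 2 * ellip_K \<kappa> / \<gamma>) = dnoidal \<phi>\<^sub>0 \<gamma> \<kappa> x"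
  using assms(2) by (simp add: dnoidal_def distrib_left jacobi_dn_add_2K[OF assms(1)])

section \<open>The one-parameter family of dnoidal waves\<close>

theorem proposition1:
  fixes c \<omega> \<sigma> \<alpha> \<beta> A :: real
  assumes "c > 1"
    and "\<omega> > c\<^sup>2 / 4"
    and "\<sigma> = \<omega> - c\<^sup>2 / 4"
    and "0 < \<alpha>" and "\<alpha> < (c - 1) / (4 * \<sigma>)"
    and "\<beta> = 3 * \<alpha>"
    and "A = 1 / (2 * (c - 1 - 4 * \<alpha> * \<sigma>))"
  shows "\<sigma> > 0 \<and> A > 0 \<and>
    (\<forall>f g :: real \<Rightarrow> real.
       solves_system \<alpha> \<beta> (wave_u \<omega> c f) (wave_v c g) \<longleftrightarrow> solves_profile c \<sigma> \<alpha> \<beta> f g) \<and>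
    (\<forall>\<kappa> :: real. 0 < \<kappa> \<and> \<kappa> < 1 \<longrightarrow>
       (\<exists>\<gamma> \<phi>\<^sub>0 :: real. \<gamma> > 0 \<and> \<phi>\<^sub>0 > 0 \<and>
          \<gamma>\<^sup>2 = \<sigma> / (2 - \<kappa>\<^sup>2) \<and> \<phi>\<^sub>0\<^sup>2 = 2 * \<gamma>\<^sup>2 / A \<and>
          (let \<phi> = (\<lambda>x. \<phi>\<^sub>0 * jacobi_dn (\<gamma> * x) \<kappa>);
               \<psi> = (\<lambda>x. A * (\<phi> x)\<^sup>2);
               b = - 4 * \<alpha> * (1 - \<kappa>\<^sup>2) * \<gamma> ^ 4;
               T = 2 * ellip_K \<kappa> / \<gamma>
           in solves_system \<alpha> \<beta> (wave_u \<omega> c \<phi>) (wave_v c \<psi>) \<and>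
              solves_profile c \<sigma> \<alpha> \<beta> \<phi> \<psi> \<and>
              b < 0 \<and> solves_integrated_profile c \<sigma> \<alpha> \<beta> b \<phi> \<psi> \<and>
              T > 0 \<and> periodic_fun_simple \<phi> T \<and> periodic_fun_simple \<psi> T)))"
proof -
  \<comment> \<open>The upper bound on \<alpha> amounts to M > 0, and A = 1 / (2M).\<close>
  define M where "M = c - 1 - 4 * \<alpha> * \<sigma>"
  have \<sigma>_pos: "\<sigma> > 0" using assms by simp
  have "\<alpha> * (4 * \<sigma>) < c - 1"
    using assms(5) \<sigma>_pos by (simp add: pos_less_divide_eq)
  then have M_pos: "M > 0" by (simp add: M_def)
  have A_M: "A = 1 / (2 * M)" using assms(7) by (simp add: M_def)
  then have A_pos: "A > 0" using M_pos by simp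
  have system_iff: "solves_system \<alpha> \<beta> (wave_u \<omega> c f) (wave_v c g) \<longleftrightarrow> solves_profile c \<sigma> \<alpha> \<beta> f g"
    for f g
    unfolding assms(3)
    using solves_system_wave_if_solves_profile solves_profile_if_solves_system_wave by blast
  have family: "\<exists>\<gamma> \<phi>\<^sub>0 :: real. \<gamma> > 0 \<and> \<phi>\<^sub>0 > 0 \<and>
          \<gamma>\<^sup>2 = \<sigma> / (2 - \<kappa>\<^sup>2) \<and> \<phi>\<^sub>0\<^sup>2 = 2 * \<gamma>\<^sup>2 / A \<and>
          (let \<phi> = (\<lambda>x. \<phi>\<^sub>0 * jacobi_dn (\<gamma> * x) \<kappa>);
               \<psi> = (\<lambda>x. A * (\<phi> x)\<^sup>2);
               b = - 4 * \<alpha> * (1 - \<kappa>\<^sup>2) * \<gamma> ^ 4;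
               T = 2 * ellip_K \<kappa> / \<gamma>
           in solves_system \<alpha> \<beta> (wave_u \<omega> c \<phi>) (wave_v c \<psi>) \<and>
              solves_profile c \<sigma> \<alpha> \<beta> \<phi> \<psi> \<and>
              b < 0 \<and> solves_integrated_profile c \<sigma> \<alpha> \<beta> b \<phi> \<psi> \<and>
              T > 0 \<and> periodic_fun_simple \<phi> T \<and> periodic_fun_simple \<psi> T)"
    if \<kappa>: "0 < \<kappa> \<and> \<kappa> < 1" for \<kappa> :: real
  proof -
    \<comment> \<open>Positive roots of the prescribed squares, which are positive since \<kappa>^2
      < 1, \<sigma> > 0 and A > 0.\<close>
    define \<gamma> where "\<gamma> = sqrt (\<sigma> / (2 - \<kappa>\<^sup>2))"
    define \<phi>\<^sub>0 where "\<phi>\<^sub>0 = sqrt (2 * \<gamma>\<^sup>2 / A)"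
    have k: "\<bar>\<kappa>\<bar> < 1" and k2: "\<kappa>\<^sup>2 < 1" using \<kappa> by (auto simp: abs_square_less_1)
    have \<gamma>: "\<gamma> > 0" "\<gamma>\<^sup>2 = \<sigma> / (2 - \<kappa>\<^sup>2)" using \<sigma>_pos k2 by (auto simp: \<gamma>_def)
    have \<phi>\<^sub>0: "\<phi>\<^sub>0 > 0" "\<phi>\<^sub>0\<^sup>2 = 2 * \<gamma>\<^sup>2 / A" using A_pos \<gamma>(1) by (auto simp: \<phi>\<^sub>0_def)
    have rel: "\<sigma> = \<gamma>\<^sup>2 * (2 - \<kappa>\<^sup>2)" "A * \<phi>\<^sub>0\<^sup>2 = 2 * \<gamma>\<^sup>2" "\<phi>\<^sub>0\<^sup>2 = 4 * \<gamma>\<^sup>2 * (c - 1 - 4 * \<alpha> * \<sigma>)"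
      using \<gamma>(2) k2 \<phi>\<^sub>0(2) A_pos by (simp, simp, simp add: A_M M_def)
    have b: "- 4 * \<alpha> * (1 - \<kappa>\<^sup>2) * \<gamma> ^ 4 < 0"
      using assms(4) k2 \<gamma>(1) by simp
    have T: "2 * ellip_K \<kappa> / \<gamma> > 0" using ellip_K_pos[OF k] \<gamma>(1) by simp
    have per: "periodic_fun_simple (dnoidal \<phi>\<^sub>0 \<gamma> \<kappa>) (2 * ellip_K \<kappa> / \<gamma>)"
      "periodic_fun_simple (\<lambda>x. A * (dnoidal \<phi>\<^sub>0 \<gamma> \<kappa> x)\<^sup>2) (2 * ellip_K \<kappa> / \<gamma>)"
      using \<gamma>(1) by (unfold_locales, simp_all add: dnoidal_periodic[OF k])
    \<comment> \<open>Unfolding \<open>system_iff\<close> replaces the claim about the system by the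
      profile claim, which is already available.\<close>
    show ?thesis
      using \<gamma> \<phi>\<^sub>0 b T per dnoidal_solves_profile[OF k assms(6) rel]
        dnoidal_solves_integrated_profile[OF k assms(6) rel]
      unfolding Let_def system_iff dnoidal_def by (intro exI[of _ \<gamma>] exI[of _ \<phi>\<^sub>0] conjI)
  qed
  show ?thesis
    using \<sigma>_pos A_pos system_iff family by (intro conjI allI impI)
qed

end
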